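(* Let $f(\mathbf\Psi,\mathbf\Omega)$, $g(\mathbf\Psi)$ and $\mathcal S$ be as defined in the context. Assume that $f(\mathbf\Psi,\mathbf\Omega)$ and $g(\mathbf\Psi)$ are continuous, and $f(\mathbf\Psi,\mathbf\Omega)$ is positive. Given $\mathbf\Psi^*\in\mathcal S$, $\mathbf\Omega^*=(\mathbf\Psi^*+\sigma^2\mathbf I_L)^{-1}$ and $\omega^*=\dfrac{f(\mathbf\Psi^*,\mathbf\Omega^* )}{g(\mathbf\Psi^* )}$. Then $\mathbf\Psi^*\in\mathcal S$ is the optimal solution to the problem $$\max_{\mathbf\Psi\in\mathcal S,\ \mathbf\Omega}\ \frac{f(\mathbf\Psi,\mathbf\Omega)}{g(\mathbf\Psi)}$$ if and only if $$(\mathbf\Psi^*,\mathbf\Omega^* )=\operatorname*{arg\,max}_{\mathbf\Psi\in\mathcal S,\ \mathbf\Omega}\ \left[f(\mathbf\Psi,\mathbf\Omega)-\omega^*g(\mathbf\Psi)\right].$$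
   Context: $\log$ is the natural logarithm and $|\cdot|$ of a matrix is its determinant. $N,K,L,M$ are positive integers (numbers of base-station antennas, macro users, remote radio heads, and all users). $\sigma^2$ is the noise power, $C_0$ a constant (normalized fronthaul capacity), $p_m$ the transmit power of user $m$ and $\mu_{lm}$ the large-scale fading coefficient between radio head $l$ and user $m$ ($1\le l\le L$, $1\le m\le M$), $p_k^{(M)}$ the transmit power of macro user $k$ and $\nu_k$ its large-scale fading coefficient to the base station ($1\le k\le K$). Put $\mathbf U_m=\mathrm{diag}(\mu_{1m},\dots,\mu_{Lm})$. $\mathcal S=\{\mathbf\Psi\mid\mathbf\Psi_{ll}\ge0,\ \mathbf\Psi_{ll'}=0,\ l\ne l',\ l=1,\dots,L\}$ is the set of $L\times L$ diagonal matrices with nonnegative diagonal entries; write $\mathbf\Psi_{ll}=\psi_l^2$. The auxiliary variable $\mathbf\Omega$ ranges over Hermitian positive semidefinite matrices in $\mathbb C^{L\times L}$. For $\mathbf\Psi\in\mathcal S$, let $b_1,\dots,b_M$ and $\mathbf\Lambda$ be determined by $b_m=p_m\,\mathrm{tr}(\mathbf U_m\mathbf\Lambda^{-1})$ and $\mathbf\Lambda=\sum_{m=1}^M\frac{p_m\mathbf U_m}{1+b_m}+\mathbf\Psi+\sigma^2\mathbf I_L$, and set $$\nabla_0=\nabla_0(\mathbf\Psi)=\log|\mathbf\Lambda|+\sum_{m=1}^M\left(\frac1{1+b_m}-\log\frac1{1+b_m}\right)-M.$$ The functions are $$f(\mathbf\Psi,\mathbf\Omega)=\bar R_0^{(B)}+\frac1{\log2}\left\{\nabla_0(\mathbf\Psi)+\log|\mathbf\Omega|-\mathrm{tr}[\mathbf\Omega(\mathbf\Psi+\sigma^2\mathbf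 I_L)]+L\right\},\qquad g(\mathbf\Psi)=\bar R_0^{(fh,\kappa)}(\mathbf\Psi)+C_0,$$ where $\kappa$ is either P2P (point-to-point compression) or WZ (Wyner-Ziv coding), $$\bar R_0^{(fh,\mathrm{P2P})}(\mathbf\Psi)=\sum_{l=1}^L\log_2\frac{\sum_{m=1}^Mp_m\mu_{lm}+\sigma^2+\psi_l^2}{\psi_l^2},\qquad \bar R_0^{(fh,\mathrm{WZ})}(\mathbf\Psi)=\frac1{\log2}\left(\nabla_0(\mathbf\Psi)-\log|\mathbf\Psi|\right),$$ and $\bar R_0^{(B)}$ is the constant (independent of $\mathbf\Psi,\mathbf\Omega$) $$\bar R_0^{(B)}=\frac1{\log2}\left(\log|\mathbf\Gamma|+\sum_{k=1}^K\left(\frac1{1+e_k}-\log\frac1{1+e_k}\right)-K-\log|\sigma^2\mathbf I_N|\right),$$ with $e_k=p_k^{(M)}\nu_k\,\mathrm{tr}(\mathbf\Gamma^{-1})$ and $\mathbf\Gamma=\left(\sum_{k=1}^K\frac{p_k^{(M)}\nu_k}{1+e_k}+\sigma^2\right)\mathbf I_N$. *)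

theory Defs
  imports "HOL-Analysis.Analysis"
begin

text \<open>
  Conventions. Matrix dimensions are the cardinalities of finite index types: 'l for the remote radio
  heads, 'm for all users, 'k for the macro users, 'n for the base-station antennas. The noise power
  is the square of the parameter \<sigma>. Diagonal matrices \<Psi> are real, and are embedded
  into the complex matrices where they meet the complex Hermitian matrix \<Omega>.

  \<Psi> may have zero diagonal entries and \<Omega> may be singular, so the logarithms of their
  determinants are extended reals.
\<close>

definition eln :: "ereal \<Rightarrow> ereal" where
  "eln x = (case x of ereal r \<Rightarrow> if 0 < r then ereal (ln r) else - \<infinity> | PInfty \<Rightarrow> \<infinity> | MInfty \<Rightarrow> - \<infinity>)"

text \<open>Only the value at nonnegative arguments matters: 0 is mapped to minus infinity.\<close>

definition cmat :: "real^'l^'l \<Rightarrow> complex^'l^'l" where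
  "cmat A = map_matrix complex_of_real A"

definition psi_set :: "(real^'l::finite^'l) set" where
  "psi_set = {\<Psi>. (\<forall>l. 0 \<le> \<Psi> $ l $ l) \<and> (\<forall>l l'. l \<noteq> l' \<longrightarrow> \<Psi> $ l $ l' = 0)}"

definition hermitian :: "complex^'l::finite^'l \<Rightarrow> bool" where
  "hermitian A \<longleftrightarrow> (\<forall>i j. A $ j $ i = cnj (A $ i $ j))"

text \<open>The quadratic form of a Hermitian matrix is real valued, as are its determinant and the trace
  of its product with a real diagonal matrix. Hence the real parts taken here and below.\<close>

definition psd_set :: "(complex^'l::finite^'l) set" where
  "psd_set = {A. hermitian A \<and> (\<forall>x. 0 \<le> Re (\<Sum>i\<in>UNIV. cnj (x $ i) * (A *v x) $ i))}"

definition U_mat :: "('l::finite \<Rightarrow> 'm \<Rightarrow> real) \<Rightarrow> 'm \<Rightarrow> real^'l^'l" where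
  "U_mat \<mu> m = (\<chi> l l'. if l = l' then \<mu> l m else 0)"

definition Lambda_of ::
  "('m::finite \<Rightarrow> real) \<Rightarrow> ('l::finite \<Rightarrow> 'm \<Rightarrow> real) \<Rightarrow> real \<Rightarrow> real^'l^'l \<Rightarrow> ('m \<Rightarrow> real) \<Rightarrow> real^'l^'l" where
  "Lambda_of p \<mu> \<sigma> \<Psi> b = (\<Sum>m\<in>UNIV. (p m / (1 + b m)) *\<^sub>R U_mat \<mu> m) + \<Psi> + mat (\<sigma>\<^sup>2)"

text \<open>The coupled equations for \<open>b\<close> and \<open>\<Lambda>\<close> determine \<open>b\<close> among nonnegative
  vectors; without the sign condition there can be further, spurious, solutions.\<close>

definition b_sol ::
  "('m::finite \<Rightarrow> real) \<Rightarrow> ('l::finite \<Rightarrow> 'm \<Rightarrow> real) \<Rightarrow> real \<Rightarrow> real^'l^'l \<Rightarrow> 'm \<Rightarrow> real" where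
  "b_sol p \<mu> \<sigma> \<Psi> = (THE b. (\<forall>m. 0 \<le> b m) \<and>
     (\<forall>m. b m = p m * trace (U_mat \<mu> m ** matrix_inv (Lambda_of p \<mu> \<sigma> \<Psi> b))))"

definition Lambda ::
  "('m::finite \<Rightarrow> real) \<Rightarrow> ('l::finite \<Rightarrow> 'm \<Rightarrow> real) \<Rightarrow> real \<Rightarrow> real^'l^'l \<Rightarrow> real^'l^'l" where
  "Lambda p \<mu> \<sigma> \<Psi> = Lambda_of p \<mu> \<sigma> \<Psi> (b_sol p \<mu> \<sigma> \<Psi>)"

definition nabla0 ::
  "('m::finite \<Rightarrow> real) \<Rightarrow> ('l::finite \<Rightarrow> 'm \<Rightarrow> real) \<Rightarrow> real \<Rightarrow> real^'l^'l \<Rightarrow> real" where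
  "nabla0 p \<mu> \<sigma> \<Psi> = ln (det (Lambda p \<mu> \<sigma> \<Psi>))
     + (\<Sum>m\<in>UNIV. 1 / (1 + b_sol p \<mu> \<sigma> \<Psi> m) - ln (1 / (1 + b_sol p \<mu> \<sigma> \<Psi> m)))
     - real CARD('m)"

definition Gamma_of ::
  "('k::finite \<Rightarrow> real) \<Rightarrow> ('k \<Rightarrow> real) \<Rightarrow> real \<Rightarrow> ('k \<Rightarrow> real) \<Rightarrow> real^'n::finite^'n" where
  "Gamma_of pM \<nu> \<sigma> e = mat ((\<Sum>k\<in>UNIV. pM k * \<nu> k / (1 + e k)) + \<sigma>\<^sup>2)"

text \<open>The type argument \<open>'n\<close> carries the number of antennas.\<close>

definition e_sol ::
  "'n::finite itself \<Rightarrow> ('k::finite \<Rightarrow> real) \<Rightarrow> ('k \<Rightarrow> real) \<Rightarrow> real \<Rightarrow> 'k \<Rightarrow> real" where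
  "e_sol _ pM \<nu> \<sigma> = (THE e. (\<forall>k. 0 \<le> e k) \<and>
     (\<forall>k. e k = pM k * \<nu> k * trace (matrix_inv (Gamma_of pM \<nu> \<sigma> e :: real^'n^'n))))"

definition rate_B ::
  "'n::finite itself \<Rightarrow> ('k::finite \<Rightarrow> real) \<Rightarrow> ('k \<Rightarrow> real) \<Rightarrow> real \<Rightarrow> real" where
  "rate_B N pM \<nu> \<sigma> = (let e = e_sol N pM \<nu> \<sigma> in
     1 / ln 2 * (ln (det (Gamma_of pM \<nu> \<sigma> e :: real^'n^'n))
       + (\<Sum>k\<in>UNIV. 1 / (1 + e k) - ln (1 / (1 + e k)))
       - real CARD('k) - ln (det (mat (\<sigma>\<^sup>2) :: real^'n^'n))))"

datatype compression = P2P | WZ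

text \<open>The fronthaul rate is infinite when \<open>\<Psi>\<close> has a zero diagonal entry
  (in \<^typ>\<open>ereal\<close>, a positive number divided by 0 is \<open>\<infinity>\<close>).\<close>

fun rate_fh ::
  "compression \<Rightarrow> ('m::finite \<Rightarrow> real) \<Rightarrow> ('l::finite \<Rightarrow> 'm \<Rightarrow> real) \<Rightarrow> real \<Rightarrow> real^'l^'l \<Rightarrow> ereal" where
  "rate_fh P2P p \<mu> \<sigma> \<Psi> = (\<Sum>l\<in>UNIV.
     eln (ereal ((\<Sum>m\<in>UNIV. p m * \<mu> l m) + \<sigma>\<^sup>2 + \<Psi> $ l $ l) / ereal (\<Psi> $ l $ l)) / ereal (ln 2))"
| "rate_fh WZ p \<mu> \<sigma> \<Psi> =
     ereal (1 / ln 2) * (ereal (nabla0 p \<mu> \<sigma> \<Psi>) - eln (ereal (det \<Psi>)))"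

definition f_obj ::
  "'n::finite itself \<Rightarrow> ('k::finite \<Rightarrow> real) \<Rightarrow> ('k \<Rightarrow> real) \<Rightarrow> ('m::finite \<Rightarrow> real) \<Rightarrow>
   ('l::finite \<Rightarrow> 'm \<Rightarrow> real) \<Rightarrow> real \<Rightarrow> real^'l^'l \<Rightarrow> complex^'l^'l \<Rightarrow> ereal" where
  "f_obj N pM \<nu> p \<mu> \<sigma> \<Psi> \<Omega> = ereal (rate_B N pM \<nu> \<sigma>) + ereal (1 / ln 2) *
     (ereal (nabla0 p \<mu> \<sigma> \<Psi>) + eln (ereal (Re (det \<Omega>)))
      - ereal (Re (trace (\<Omega> ** cmat (\<Psi> + mat (\<sigma>\<^sup>2))))) + ereal (real CARD('l)))"

definition g_obj ::
  "compression \<Rightarrow> real \<Rightarrow> ('m::finite \<Rightarrow> real) \<Rightarrow> ('l::finite \<Rightarrow> 'm \<Rightarrow> real) \<Rightarrow> real \<Rightarrow> real^'l^'l \<Rightarrow> ereal" where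
  "g_obj \<kappa> C0 p \<mu> \<sigma> \<Psi> = rate_fh \<kappa> p \<mu> \<sigma> \<Psi> + ereal C0"

definition Omega_opt :: "real \<Rightarrow> real^'l::finite^'l \<Rightarrow> complex^'l^'l" where
  "Omega_opt \<sigma> \<Psi> = matrix_inv (cmat (\<Psi> + mat (\<sigma>\<^sup>2)))"

end

theory Submission
  imports Defs
begin

text \<open>
  Since \<open>g > 0\<close>, Dinkelbach's equivalence between \<open>f / g \<le> \<omega>\<close> and \<open>f - \<omega> g \<le> 0\<close> gives both
  directions, once \<open>f\<close> is known to be maximal over \<open>\<Omega>\<close> at \<open>\<Omega> = (\<Psi> + \<sigma>\<^sup>2 I)\<^sup>-\<^sup>1\<close>. The latter follows from
  Hadamard's inequality, proved by symmetric Gaussian elimination, and \<open>ln x \<le> x - 1\<close> applied to each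
  diagonal entry. For Wyner-Ziv coding, positivity of \<open>g\<close> requires the equations for \<open>b\<close> to have exactly
  one nonnegative solution. Their right-hand side is a monotone, bounded, strictly subhomogeneous
  map: the supremum of the points \<open>b \<le> T b\<close> is a fixed point, and comparing two fixed points along the
  largest ratio of their entries shows uniqueness.
\<close>

section \<open>Hadamard's determinant inequality for positive semidefinite matrices\<close>

text \<open>The quadratic form of \<open>E ** A ** F\<close> at \<open>x\<close> is that of
  \<open>A\<close> at \<open>F *v x\<close>, because \<open>F\<close> is the conjugate transpose of
  \<open>E\<close>. This keeps each elimination step below inside \<open>psd_set\<close>.\<close>

lemma psd_conj_transpose:
  fixes A E F :: "complex^'n^'n"
  assumes A: "A \<in> psd_set" and F: "\<And>i j. F $ i $ j = cnj (E $ j $ i)"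
  shows "E ** A ** F \<in> psd_set"
proof -
  have herm: "A $ j $ i = cnj (A $ i $ j)" for i j
    using A unfolding psd_set_def hermitian_def by blast
  have pos: "0 \<le> Re (\<Sum>i\<in>UNIV. cnj (x $ i) * (A *v x) $ i)" for x
    using A unfolding psd_set_def by blast
  have "(E ** A ** F) $ j $ i = cnj ((E ** A ** F) $ i $ j)" for i j
  proof -
    have "(E ** A ** F) $ j $ i = (\<Sum>s\<in>UNIV. \<Sum>r\<in>UNIV. E $ j $ r * A $ r $ s * F $ s $ i)"
      by (simp add: matrix_matrix_mult_def sum_distrib_right)
    also have "\<dots> = (\<Sum>r\<in>UNIV. \<Sum>s\<in>UNIV. E $ j $ r * A $ r $ s * F $ s $ i)"
      by (rule sum.swap)
    also have "\<dots> = (\<Sum>r\<in>UNIV. \<Sum>s\<in>UNIV. cnj (E $ i $ s * A $ s $ r * F $ r $ j))"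
    proof (intro sum.cong refl)
      fix r s
      have "A $ r $ s = cnj (A $ s $ r)" by (rule herm)
      then show "E $ j $ r * A $ r $ s * F $ s $ i = cnj (E $ i $ s * A $ s $ r * F $ r $ j)"
        by (simp add: F mult_ac)
    qed
    also have "\<dots> = cnj ((E ** A ** F) $ i $ j)"
      by (simp add: matrix_matrix_mult_def sum_distrib_right)
    finally show ?thesis .
  qed
  moreover have "0 \<le> Re (\<Sum>i\<in>UNIV. cnj (x $ i) * ((E ** A ** F) *v x) $ i)" for x
  proof -
    define w where "w = A *v (F *v x)"
    have "(E ** A ** F) *v x = E *v w"
      unfolding w_def by (simp add: matrix_vector_mul_assoc matrix_mul_assoc)
    then have "(\<Sum>i\<in>UNIV. cnj (x $ i) * ((E ** A ** F) *v x) $ i)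
        = (\<Sum>i\<in>UNIV. \<Sum>j\<in>UNIV. cnj (x $ i) * E $ i $ j * w $ j)"
      by (simp add: matrix_vector_mult_def sum_distrib_left mult.assoc)
    also have "\<dots> = (\<Sum>j\<in>UNIV. \<Sum>i\<in>UNIV. cnj (x $ i) * E $ i $ j * w $ j)"
      by (rule sum.swap)
    also have "\<dots> = (\<Sum>j\<in>UNIV. cnj ((F *v x) $ j) * w $ j)"
      by (simp add: matrix_vector_mult_def sum_distrib_left sum_distrib_right F mult_ac)
    finally show ?thesis
      using pos[of "F *v x"] unfolding w_def by simp
  qed
  ultimately show ?thesis
    unfolding psd_set_def hermitian_def by blast
qed

lemma psd_diag:
  assumes "A \<in> psd_set"
  shows "0 \<le> Re (A $ k $ k)" and "A $ k $ k = complex_of_real (Re (A $ k $ k))"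
proof -
  have "0 \<le> Re (\<Sum>i\<in>UNIV. cnj (axis k 1 $ i) * (A *v axis k 1) $ i)"
    using assms unfolding psd_set_def by blast
  also have "(\<Sum>i\<in>UNIV. cnj (axis k 1 $ i) * (A *v axis k 1) $ i) = A $ k $ k"
    by (simp add: matrix_vector_mult_def axis_def if_distrib if_distribR cong: if_cong)
  finally show "0 \<le> Re (A $ k $ k)" .
  have "A $ k $ k = cnj (A $ k $ k)"
    using assms unfolding psd_set_def hermitian_def by blast
  then show "A $ k $ k = complex_of_real (Re (A $ k $ k))"
    by (metis Reals_cnj_iff complex_is_Real_iff of_real_Re)
qed

text \<open>At the vector with entry \<open>- s * A $ k $ j\<close> in position \<open>k\<close> and
  1 in position \<open>j\<close>, the quadratic form is \<open>A $ j $ j\<close> minus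
  \<open>2 * s\<close> times the squared modulus of \<open>A $ k $ j\<close>. If that modulus were
  positive, a large \<open>s\<close> would make the form negative.\<close>

lemma psd_zero_diag_imp_zero_row:
  fixes A :: "complex^'n^'n"
  assumes A: "A \<in> psd_set" and zero: "A $ k $ k = 0"
  shows "A $ k $ j = 0"
proof (cases "j = k")
  case False
  have herm: "A $ j $ k = cnj (A $ k $ j)"
    using A unfolding psd_set_def hermitian_def by blast
  \<comment> \<open>Chosen so that, for nonzero \<open>A $ k $ j\<close>, the subtracted term equals
    \<open>Re (A $ j $ j) + 1\<close> and the form would be -1.\<close>
  define s where "s = (Re (A $ j $ j) + 1) / (2 * (cmod (A $ k $ j))\<^sup>2)"
  define x :: "complex^'n" where
    "x = (\<chi> i. if i = k then - of_real s * A $ k $ j else if i = j then 1 else 0)"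
  have split: "(\<Sum>i\<in>UNIV. h i) = h k + h j" if "\<And>i. i \<noteq> k \<Longrightarrow> i \<noteq> j \<Longrightarrow> h i = 0" for h :: "'n \<Rightarrow> complex"
  proof -
    have "(\<Sum>i\<in>UNIV. h i) = (\<Sum>i\<in>{k, j}. h i)"
      by (rule sum.mono_neutral_right) (use that in auto)
    then show ?thesis using False by simp
  qed
  have Ax: "(A *v x) $ i = A $ i $ k * x $ k + A $ i $ j * x $ j" for i
    unfolding matrix_vector_mult_def vec_lambda_beta by (rule split) (simp add: x_def)
  have "(\<Sum>i\<in>UNIV. cnj (x $ i) * (A *v x) $ i)
      = cnj (x $ k) * (A *v x) $ k + cnj (x $ j) * (A *v x) $ j"
    by (rule split) (simp add: x_def)
  also have "\<dots> = - of_real s * cnj (A $ k $ j) * A $ k $ j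
      + (- of_real s * cnj (A $ k $ j) * A $ k $ j + A $ j $ j)"
    unfolding Ax using False zero herm by (simp add: x_def)
  also have "\<dots> = A $ j $ j - of_real (2 * s * (cmod (A $ k $ j))\<^sup>2)"
    using complex_norm_square[of "A $ k $ j"] by (simp add: algebra_simps)
  finally have "0 \<le> Re (A $ j $ j - of_real (2 * s * (cmod (A $ k $ j))\<^sup>2))"
    using A unfolding psd_set_def by (metis (mono_tags, lifting) mem_Collect_eq)
  then have "2 * s * (cmod (A $ k $ j))\<^sup>2 \<le> Re (A $ j $ j)"
    by simp
  then show ?thesis
    by (cases "A $ k $ j = 0") (simp_all add: s_def)
qed (use zero in simp)

text \<open>Since \<open>c k = 0\<close>, the vector added to row \<open>k\<close> of the identity
  is a combination of the other rows, so \<open>det_row_span\<close> applies. The elimination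
  matrices below therefore have determinant 1.\<close>

lemma det_mat_1_add_row:
  fixes c :: "'n::finite \<Rightarrow> 'a::field"
  assumes "c k = 0"
  shows "det (\<chi> i j. (if i = j then 1 else 0) + (if i = k then c j else 0)) = 1"
proof -
  define x :: "'a^'n" where "x = (\<chi> j. c j)"
  have "x = (\<Sum>j\<in>UNIV. c j *s axis j 1)"
    by (simp add: x_def vec_eq_iff axis_def if_distrib cong: if_cong)
  also have "\<dots> \<in> vec.span {row j (mat 1 :: 'a^'n^'n) | j. j \<noteq> k}"
  proof (rule vec.span_sum)
    fix j
    show "c j *s axis j 1 \<in> vec.span {row j (mat 1 :: 'a^'n^'n) | j. j \<noteq> k}"
    proof (cases "j = k")
      case True
      then show ?thesis using assms vec.span_zero by simp
    next
      case False
      have "axis j 1 = row j (mat 1 :: 'a^'n^'n)"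
        by (simp add: vec_eq_iff axis_def row_def mat_def)
      with False show ?thesis
        by (intro vec.span_scale vec.span_base) blast
    qed
  qed
  finally have "det (\<chi> i. if i = k then row k (mat 1 :: 'a^'n^'n) + x else row i (mat 1)) = det (mat 1 :: 'a^'n^'n)"
    by (rule det_row_span)
  moreover have "(\<chi> i. if i = k then row k (mat 1 :: 'a^'n^'n) + x else row i (mat 1))
      = (\<chi> i j. (if i = j then 1 else 0) + (if i = k then c j else 0))"
    by (auto simp: vec_eq_iff row_def mat_def x_def)
  ultimately show ?thesis by simp
qed

text \<open>\<open>S\<close> holds the rows still to be cleared. With a nonzero pivot
  \<open>d\<close>, a congruence clears row and column \<open>k\<close>; it preserves the
  determinant and subtracts a nonnegative amount from each other diagonal entry, so the product of
  the diagonal can only shrink. A zero pivot forces a zero row and hence determinant 0. Once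
  \<open>S\<close> is empty the matrix is diagonal and equality holds.\<close>

lemma psd_det_le_prod_diag_aux:
  fixes A :: "complex^'n^'n"
  assumes "finite S" "A \<in> psd_set" "\<And>i j. i \<notin> S \<Longrightarrow> i \<noteq> j \<Longrightarrow> A $ i $ j = 0"
  shows "Re (det A) \<le> (\<Prod>i\<in>UNIV. Re (A $ i $ i))"
  using assms
proof (induction S arbitrary: A rule: finite_induct)
  case empty
  then have "det A = (\<Prod>i\<in>UNIV. A $ i $ i)"
    by (intro det_diagonal) auto
  also have "\<dots> = (\<Prod>i\<in>UNIV. complex_of_real (Re (A $ i $ i)))"
    by (intro prod.cong refl psd_diag(2) empty)
  also have "\<dots> = complex_of_real (\<Prod>i\<in>UNIV. Re (A $ i $ i))"
    by simp
  finally show ?case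
    by (metis Re_complex_of_real order_refl)
next
  case (insert k S)
  note A = \<open>A \<in> psd_set\<close>
  show ?case
  proof (cases "A $ k $ k = 0")
    case True
    then have "row k A = 0"
      using psd_zero_diag_imp_zero_row[OF A] by (simp add: row_def vec_eq_iff)
    then have "det A = 0" by (rule det_zero_row)
    then show ?thesis using psd_diag(1)[OF A] by (simp add: prod_nonneg)
  next
    case False
    define d where "d = Re (A $ k $ k)"
    have Akk: "A $ k $ k = of_real d" and d: "d > 0"
      using psd_diag[OF A, of k] False unfolding d_def by (auto simp: less_le)
    have herm: "A $ j $ i = cnj (A $ i $ j)" for i j
      using A unfolding psd_set_def hermitian_def by blast
    \<comment> \<open>Adding \<open>c i\<close> times row \<open>k\<close> to row \<open>i\<close>
      cancels the entry in column \<open>k\<close>. \<open>E\<close> performs these row operations,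
      and \<open>F\<close> the conjugate column operations.\<close>
    define c where "c i = (if i = k then 0 else - A $ i $ k / of_real d)" for i
    define F :: "complex^'n^'n" where
      "F = (\<chi> i j. (if i = j then 1 else 0) + (if i = k then cnj (c j) else 0))"
    define E :: "complex^'n^'n" where
      "E = transpose (\<chi> i j. (if i = j then 1 else 0) + (if i = k then c j else 0))"
    define C where "C = E ** A ** F"
    have detC: "det C = det A"
      unfolding C_def E_def F_def det_mul det_transpose
      by (subst (1 2) det_mat_1_add_row) (auto simp: c_def)
    have C: "C \<in> psd_set"
      unfolding C_def by (rule psd_conj_transpose[OF A]) (simp add: E_def F_def transpose_def)
    have EA: "(E ** A) $ i $ j = A $ i $ j + c i * A $ k $ j" for i j
      by (simp add: E_def matrix_matrix_mult_def transpose_def distrib_right sum.distrib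
          mult_delta_left)
    have "C $ i $ j = (E ** A) $ i $ j + (E ** A) $ i $ k * cnj (c j)" for i j
      unfolding C_def matrix_matrix_mult_def[of _ F]
      by (simp add: F_def distrib_left sum.distrib mult_delta_right)
    then have Cij: "C $ i $ j = A $ i $ j + c i * A $ k $ j + (A $ i $ k + c i * A $ k $ k) * cnj (c j)" for i j
      by (simp add: EA)
    have offk: "A $ i $ k + c i * A $ k $ k = 0" if "i \<noteq> k" for i
      using that d by (simp add: c_def Akk)
    have "C $ i $ j = 0" if "i \<notin> S" "i \<noteq> j" for i j
    proof (cases "i = k")
      case True
      then show ?thesis using that d herm[of j k] by (simp add: Cij c_def Akk)
    next
      \<comment> \<open>Row \<open>i\<close> is already cleared, so its multiplier
        \<open>c i\<close> is 0 and the elimination leaves the row zero off the diagonal.\<close>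
      case False
      then have "A $ i $ j = 0" "A $ i $ k = 0" using that insert.prems(2) by auto
      with False show ?thesis by (simp add: Cij c_def)
    qed
    then have "Re (det C) \<le> (\<Prod>i\<in>UNIV. Re (C $ i $ i))"
      using insert.IH[OF C] by blast
    also have "\<dots> \<le> (\<Prod>i\<in>UNIV. Re (A $ i $ i))"
    proof (rule prod_mono, intro conjI)
      fix i
      show "0 \<le> Re (C $ i $ i)" by (rule psd_diag[OF C])
      show "Re (C $ i $ i) \<le> Re (A $ i $ i)"
      proof (cases "i = k")
        case False
        then have "C $ i $ i = A $ i $ i + c i * A $ k $ i"
          using offk by (simp add: Cij)
        also have "c i * A $ k $ i = - of_real ((cmod (A $ i $ k))\<^sup>2 / d)"
          using False complex_norm_square[of "A $ i $ k"] herm[of k i] by (simp add: c_def)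
        finally show ?thesis using d by simp
      qed (simp add: Cij c_def)
    qed
    finally show ?thesis by (simp add: detC)
  qed
qed

lemma psd_det_le_prod_diag:
  "A \<in> psd_set \<Longrightarrow> Re (det A) \<le> (\<Prod>i\<in>UNIV. Re (A $ i $ i))"
  by (rule psd_det_le_prod_diag_aux[of UNIV]) auto

lemma matrix_inv_diagonal:
  fixes D :: "'a::field^'n^'n"
  assumes off: "\<And>i j. i \<noteq> j \<Longrightarrow> D $ i $ j = 0" and nz: "\<And>i. D $ i $ i \<noteq> 0"
  shows "matrix_inv D = (\<chi> i j. if i = j then 1 / D $ i $ i else 0)" (is "_ = ?E")
proof -
  have "(D ** ?E) $ i $ j = D $ i $ j * (1 / D $ j $ j)" for i j
    by (simp add: matrix_matrix_mult_def mult_delta_right)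
  then have DE: "D ** ?E = mat 1"
    using off nz by (simp add: vec_eq_iff mat_def)
  have "(?E ** D) $ i $ j = 1 / D $ i $ i * D $ i $ j" for i j
    by (simp add: matrix_matrix_mult_def mult_delta_left)
  then have ED: "?E ** D = mat 1"
    using off nz by (simp add: vec_eq_iff mat_def)
  have "D ** matrix_inv D = mat 1 \<and> matrix_inv D ** D = mat 1"
    unfolding matrix_inv_def by (rule someI_ex) (use DE ED in blast)
  moreover have "?E ** (D ** matrix_inv D) = matrix_inv D"
    unfolding matrix_mul_assoc ED by simp
  ultimately show ?thesis by simp
qed

section \<open>Unique fixed points of bounded, strictly subhomogeneous monotone maps\<close>

text \<open>These are the standard interference functions of power control, except that coordinates
  may vanish: \<open>scale\<close> is asked only where \<open>T b m\<close> is positive, and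
  \<open>zero\<close> makes the vanishing of a coordinate independent of the point.
  \<open>bounded\<close> makes the supremum of the points below their image finite.\<close>

lemma bounded_interference_ex1_fixpoint:
  fixes T :: "('m::finite \<Rightarrow> real) \<Rightarrow> 'm \<Rightarrow> real"
  assumes nonneg: "\<And>b m. (\<And>i. 0 \<le> b i) \<Longrightarrow> 0 \<le> T b m"
    and bounded: "\<And>b m. (\<And>i. 0 \<le> b i) \<Longrightarrow> T b m \<le> B m"
    and mono: "\<And>b c m. (\<And>i. 0 \<le> b i) \<Longrightarrow> (\<And>i. b i \<le> c i) \<Longrightarrow> T b m \<le> T c m"
    and scale: "\<And>a b m. (\<And>i. 0 \<le> b i) \<Longrightarrow> 1 < a \<Longrightarrow> 0 < T b m \<Longrightarrow> T (\<lambda>i. a * b i) m < a * T b m"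
    and zero: "\<And>b c m. (\<And>i. 0 \<le> b i) \<Longrightarrow> (\<And>i. 0 \<le> c i) \<Longrightarrow> T b m = 0 \<Longrightarrow> T c m = 0"
  shows "\<exists>!b. (\<forall>m. 0 \<le> b m) \<and> (\<forall>m. b m = T b m)"
proof -
  define S where "S = {b. (\<forall>m. 0 \<le> b m) \<and> (\<forall>m. b m \<le> T b m)}"
  define s where "s m = (SUP b\<in>S. b m)" for m
  have S0: "(\<lambda>_. 0) \<in> S"
    unfolding S_def using nonneg by simp
  have bdd: "bdd_above ((\<lambda>b. b m) ` S)" for m
  proof (rule bdd_aboveI2)
    fix b assume "b \<in> S"
    then have "b m \<le> T b m" "T b m \<le> B m" unfolding S_def by (auto intro: bounded)
    then show "b m \<le> B m" by (rule order_trans)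
  qed
  have s_upper: "b m \<le> s m" if "b \<in> S" for b m
    unfolding s_def using that bdd by (rule cSUP_upper)
  have s0: "0 \<le> s m" for m
    using s_upper[OF S0] .
  have s_le: "s m \<le> T s m" for m
    unfolding s_def[of m]
  proof (rule cSUP_least)
    fix b assume b: "b \<in> S"
    have "b m \<le> T b m" using b unfolding S_def by blast
    also have "\<dots> \<le> T s m"
      using b s_upper unfolding S_def by (intro mono) auto
    finally show "b m \<le> T s m" .
  qed (use S0 in blast)
  \<comment> \<open>By monotonicity the image of \<open>s\<close> also lies below its own image, so
    it cannot exceed the supremum \<open>s\<close>.\<close>
  have "T s \<in> S"
    unfolding S_def using s0 s_le by (auto intro: nonneg mono)
  then have "T s m \<le> s m" for m by (rule s_upper)
  with s_le have fixpoint: "s m = T s m" for m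
    by (metis order_antisym)
  have le: "b m \<le> c m"
    if b: "\<And>m. 0 \<le> b m" "\<And>m. b m = T b m" and c: "\<And>m. 0 \<le> c m" "\<And>m. c m = T c m" for b c m
  proof (rule ccontr)
    assume not: "\<not> b m \<le> c m"
    have bz: "b i = 0" if "c i = 0" for i
      using zero[of c b i] b c that by metis
    \<comment> \<open>Coordinates with \<open>c i = 0\<close> contribute the ratio 0 (division by
      zero) and satisfy \<open>b i = 0\<close> by \<open>bz\<close>, so
      \<open>b i \<le> a * c i\<close> holds for them too.\<close>
    define a where "a = Max (range (\<lambda>i. b i / c i))"
    have ratio: "b i / c i \<le> a" for i
      unfolding a_def by (rule Max_ge) auto
    have ub: "b i \<le> a * c i" for i
    proof (cases "c i = 0")
      case False
      with c(1)[of i] have "0 < c i" by simp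
      with ratio[of i] show ?thesis by (simp add: pos_divide_le_eq)
    qed (simp add: bz)
    have cm: "0 < c m" using c(1)[of m] bz[of m] not by fastforce
    with not have "1 < b m / c m" by simp
    with ratio[of m] have a: "1 < a" by simp
    have "a \<in> range (\<lambda>i. b i / c i)"
      unfolding a_def by (rule Max_in) auto
    then obtain k where k: "a = b k / c k" by blast
    with a have "c k \<noteq> 0" by auto
    with c(1)[of k] have ck: "0 < c k" by simp
    \<comment> \<open>At a coordinate \<open>k\<close> attaining the largest ratio,
      \<open>b k = a * c k\<close>, which strict subhomogeneity contradicts.\<close>
    have "b k = T b k" by (rule b)
    also have "\<dots> \<le> T (\<lambda>i. a * c i) k" by (rule mono) (use b ub in auto)
    also have "\<dots> < a * T c k"
      by (rule scale) (use c a ck in metis)+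
    also have "\<dots> = b k" using k ck c(2)[of k] by simp
    finally show False by simp
  qed
  show ?thesis
  proof (rule ex1I[of _ s])
    show "(\<forall>m. 0 \<le> s m) \<and> (\<forall>m. s m = T s m)" using s0 fixpoint by blast
    fix b assume b: "(\<forall>m. 0 \<le> b m) \<and> (\<forall>m. b m = T b m)"
    show "b = s"
    proof
      fix m
      show "b m = s m"
        by (rule order_antisym; rule le) (use b s0 fixpoint in blast)+
    qed
  qed
qed

section \<open>The equations for \<open>b\<close> and positivity of the fronthaul rate\<close>

context
  fixes p :: "'m::finite \<Rightarrow> real" and \<mu> :: "'l::finite \<Rightarrow> 'm \<Rightarrow> real" and \<sigma> :: real
    and \<Psi> :: "real^'l^'l"
  assumes \<sigma>: "0 < \<sigma>" and p: "\<And>m. 0 \<le> p m" and \<mu>: "\<And>l m. 0 \<le> \<mu> l m" and \<Psi>: "\<Psi> \<in> psi_set"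
begin

text \<open>All matrices in the equations for \<open>b\<close> are diagonal, so these entries of
  \<open>Lambda_of\<close> turn the matrix problem into a scalar one.\<close>

definition Lambda_diag :: "('m \<Rightarrow> real) \<Rightarrow> 'l \<Rightarrow> real" where
  "Lambda_diag b l = (\<Sum>m\<in>UNIV. p m * \<mu> l m / (1 + b m)) + \<Psi> $ l $ l + \<sigma>\<^sup>2"

lemma psi_nonneg: "0 \<le> \<Psi> $ l $ l" and psi_off: "i \<noteq> j \<Longrightarrow> \<Psi> $ i $ j = 0"
  using \<Psi> unfolding psi_set_def by auto

lemma Lambda_diag_ge: "(\<And>m. 0 \<le> b m) \<Longrightarrow> \<Psi> $ l $ l + \<sigma>\<^sup>2 \<le> Lambda_diag b l"
  unfolding Lambda_diag_def using p \<mu> by (simp add: sum_nonneg)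

lemma Lambda_diag_pos: "(\<And>m. 0 \<le> b m) \<Longrightarrow> 0 < Lambda_diag b l"
  using Lambda_diag_ge[of b l] \<sigma> psi_nonneg[of l] by (smt (verit) zero_less_power)

lemma Lambda_of_eq_diag: "Lambda_of p \<mu> \<sigma> \<Psi> b = (\<chi> i j. if i = j then Lambda_diag b i else 0)"
  by (auto simp: vec_eq_iff Lambda_of_def Lambda_diag_def U_mat_def mat_def psi_off)

lemma trace_Lambda_inv:
  assumes "\<And>m. 0 \<le> b m"
  shows "trace (U_mat \<mu> m ** matrix_inv (Lambda_of p \<mu> \<sigma> \<Psi> b)) = (\<Sum>l\<in>UNIV. \<mu> l m / Lambda_diag b l)"
proof -
  have "Lambda_diag b l \<noteq> 0" for l using Lambda_diag_pos[of b l] assms by simp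
  then have "matrix_inv (Lambda_of p \<mu> \<sigma> \<Psi> b) = (\<chi> i j. if i = j then 1 / Lambda_diag b i else 0)"
    by (subst matrix_inv_diagonal) (auto simp: Lambda_of_eq_diag vec_eq_iff)
  then show ?thesis
    by (simp add: trace_def matrix_matrix_mult_def U_mat_def mult_delta_left)
qed

text \<open>The right-hand side of the equations for \<open>b\<close>, with the trace written
  out.\<close>

definition b_map :: "('m \<Rightarrow> real) \<Rightarrow> 'm \<Rightarrow> real" where
  "b_map b m = p m * (\<Sum>l\<in>UNIV. \<mu> l m / Lambda_diag b l)"

lemma b_map_nonneg: "(\<And>m. 0 \<le> b m) \<Longrightarrow> 0 \<le> b_map b m"
  unfolding b_map_def using p \<mu> by (intro mult_nonneg_nonneg sum_nonneg divide_nonneg_pos Lambda_diag_pos)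

lemma Lambda_diag_antimono:
  assumes "\<And>m. 0 \<le> b m" "\<And>m. b m \<le> c m"
  shows "Lambda_diag c l \<le> Lambda_diag b l"
  unfolding Lambda_diag_def
proof (intro add_right_mono sum_mono)
  fix m
  show "p m * \<mu> l m / (1 + c m) \<le> p m * \<mu> l m / (1 + b m)"
    using assms(1)[of m] assms(2)[of m] p \<mu>
    by (intro divide_left_mono mult_nonneg_nonneg mult_pos_pos) auto
qed

text \<open>Moving the factor \<open>a\<close> into a denominator turns \<open>1 + a * b m\<close>
  into \<open>1 / a + b m\<close>, which is at most \<open>1 + b m\<close>. Strictness comes from
  the noise term \<open>\<sigma>\<^sup>2\<close>.\<close>

lemma Lambda_diag_scale:
  assumes b: "\<And>m. 0 \<le> b m" and a: "1 < a"
  shows "Lambda_diag b l < a * Lambda_diag (\<lambda>m. a * b m) l"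
proof -
  have "p m * \<mu> l m / (1 + b m) \<le> a * (p m * \<mu> l m / (1 + a * b m))" for m
  proof -
    have "a * (p m * \<mu> l m / (1 + a * b m)) = p m * \<mu> l m / (1 / a + b m)"
      using a b[of m] by (simp add: field_simps)
    moreover have "p m * \<mu> l m / (1 + b m) \<le> p m * \<mu> l m / (1 / a + b m)"
      using a b[of m] p \<mu>
      by (intro divide_left_mono mult_nonneg_nonneg mult_pos_pos add_pos_nonneg) auto
    ultimately show ?thesis by simp
  qed
  then have "(\<Sum>m\<in>UNIV. p m * \<mu> l m / (1 + b m)) \<le> a * (\<Sum>m\<in>UNIV. p m * \<mu> l m / (1 + a * b m))"
    unfolding sum_distrib_left by (intro sum_mono)
  moreover have "\<Psi> $ l $ l \<le> a * \<Psi> $ l $ l"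
    using a psi_nonneg[of l] by (simp add: mult_le_cancel_right1)
  moreover have "\<sigma>\<^sup>2 < a * \<sigma>\<^sup>2" using a \<sigma> by simp
  ultimately show ?thesis unfolding Lambda_diag_def by (simp add: distrib_left)
qed

lemma b_map_mono:
  assumes "\<And>m. 0 \<le> b m" "\<And>m. b m \<le> c m"
  shows "b_map b m \<le> b_map c m"
proof -
  have c: "0 \<le> c i" for i using assms by (rule order_trans)
  show ?thesis
    unfolding b_map_def using p \<mu> assms
    by (intro mult_left_mono sum_mono divide_left_mono Lambda_diag_antimono mult_pos_pos Lambda_diag_pos c)
qed

lemma b_map_bounded:
  assumes "\<And>m. 0 \<le> b m"
  shows "b_map b m \<le> p m * (\<Sum>l\<in>UNIV. \<mu> l m / \<sigma>\<^sup>2)"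
proof -
  have "\<sigma>\<^sup>2 \<le> Lambda_diag b l" for l
    using Lambda_diag_ge[of b l] assms psi_nonneg[of l] by simp
  then show ?thesis
    unfolding b_map_def using p \<mu> assms \<sigma>
    by (intro mult_left_mono sum_mono divide_left_mono mult_pos_pos Lambda_diag_pos) auto
qed

text \<open>The criterion does not involve \<open>b\<close>; this yields the hypothesis
  \<open>zero\<close> of the fixed-point lemma.\<close>

lemma b_map_eq_0_iff:
  assumes "\<And>m. 0 \<le> b m"
  shows "b_map b m = 0 \<longleftrightarrow> p m = 0 \<or> (\<forall>l. \<mu> l m = 0)"
proof -
  have nz: "Lambda_diag b l \<noteq> 0" for l using Lambda_diag_pos[of b l] assms by simp
  have "(\<Sum>l\<in>UNIV. \<mu> l m / Lambda_diag b l) = 0 \<longleftrightarrow> (\<forall>l. \<mu> l m / Lambda_diag b l = 0)"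
    using \<mu> by (subst sum_nonneg_eq_0_iff) (auto intro!: divide_nonneg_pos Lambda_diag_pos assms)
  then show ?thesis unfolding b_map_def by (simp add: nz)
qed

text \<open>\<open>Lambda_diag_scale\<close> bounds the sum term by term. A positive value of
  \<open>b_map b m\<close> provides a radio head \<open>k\<close> with \<open>\<mu> k m > 0\<close>,
  whose term is strictly smaller.\<close>

lemma b_map_scale:
  assumes b: "\<And>m. 0 \<le> b m" and a: "1 < a" and pos: "0 < b_map b m"
  shows "b_map (\<lambda>m. a * b m) m < a * b_map b m"
proof -
  have ab: "0 \<le> a * b i" for i using b a by simp
  have nz: "p m > 0" "\<not> (\<forall>l. \<mu> l m = 0)"
    using pos b_map_eq_0_iff[of b m] b p[of m] by (auto simp: less_le)
  then obtain k where k: "\<mu> k m > 0" using \<mu> by (metis less_le)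
  have inv: "1 / Lambda_diag (\<lambda>m. a * b m) l < a / Lambda_diag b l" for l
    using Lambda_diag_scale[of b a l] Lambda_diag_pos[of b l] Lambda_diag_pos[of "\<lambda>m. a * b m" l] a b ab
    by (simp add: field_simps)
  have "(\<Sum>l\<in>UNIV. \<mu> l m / Lambda_diag (\<lambda>m. a * b m) l) < a * (\<Sum>l\<in>UNIV. \<mu> l m / Lambda_diag b l)"
    unfolding sum_distrib_left
  proof (rule sum_strict_mono_ex1)
    show "\<forall>l\<in>UNIV. \<mu> l m / Lambda_diag (\<lambda>m. a * b m) l \<le> a * (\<mu> l m / Lambda_diag b l)"
    proof
      fix l
      show "\<mu> l m / Lambda_diag (\<lambda>m. a * b m) l \<le> a * (\<mu> l m / Lambda_diag b l)"
        using mult_left_mono[OF less_imp_le[OF inv[of l]] \<mu>[of l m]] by (simp add: mult_ac)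
    qed
    show "\<exists>l\<in>UNIV. \<mu> l m / Lambda_diag (\<lambda>m. a * b m) l < a * (\<mu> l m / Lambda_diag b l)"
      using mult_strict_left_mono[OF inv[of k] k] by (intro bexI[of _ k]) (auto simp: mult_ac)
  qed simp
  then show ?thesis
    unfolding b_map_def using nz(1) by (simp add: mult.left_commute)
qed

text \<open>\<open>b_sol\<close> is a definite description, so its sign is available only after
  existence and uniqueness of the solution.\<close>

lemma b_sol_nonneg: "0 \<le> b_sol p \<mu> \<sigma> \<Psi> m"
proof -
  have "\<exists>!b. (\<forall>m. 0 \<le> b m) \<and> (\<forall>m. b m = b_map b m)"
  proof (rule bounded_interference_ex1_fixpoint)
    show "b_map b m = 0 \<Longrightarrow> b_map c m = 0" if "\<And>i. 0 \<le> b i" "\<And>i. 0 \<le> c i" for b c m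
      using that by (simp add: b_map_eq_0_iff)
  qed (fact b_map_nonneg b_map_bounded b_map_mono b_map_scale)+
  \<comment> \<open>The trace formula is proved for nonnegative \<open>b\<close> only, so the two
    descriptions are compared under the sign condition.\<close>
  moreover have eq: "b_map b m = p m * trace (U_mat \<mu> m ** matrix_inv (Lambda_of p \<mu> \<sigma> \<Psi> b))"
    if "\<forall>m. 0 \<le> b m" for b m
    using that by (simp add: b_map_def trace_Lambda_inv)
  have "((\<forall>m. 0 \<le> b m) \<and> (\<forall>m. b m = b_map b m)) \<longleftrightarrow>
      ((\<forall>m. 0 \<le> b m) \<and>
       (\<forall>m. b m = p m * trace (U_mat \<mu> m ** matrix_inv (Lambda_of p \<mu> \<sigma> \<Psi> b))))" for b
    by (intro conj_cong refl) (simp add: eq)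
  ultimately have "\<exists>!b. (\<forall>m. 0 \<le> b m) \<and>
       (\<forall>m. b m = p m * trace (U_mat \<mu> m ** matrix_inv (Lambda_of p \<mu> \<sigma> \<Psi> b)))"
    by simp
  from theI'[OF this] show ?thesis unfolding b_sol_def by blast
qed

text \<open>Each diagonal entry of \<open>Lambda\<close> exceeds that of \<Psi> by at least
  \<open>\<sigma>\<^sup>2\<close>, and \<open>x - ln x \<ge> 1\<close> lets the sum over the users
  compensate the subtracted number of users.\<close>

lemma ln_det_less_nabla0:
  assumes pos: "0 < det \<Psi>"
  shows "ln (det \<Psi>) < nabla0 p \<mu> \<sigma> \<Psi>"
proof -
  let ?b = "b_sol p \<mu> \<sigma> \<Psi>"
  have det: "det \<Psi> = (\<Prod>l\<in>UNIV. \<Psi> $ l $ l)"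
    by (rule det_diagonal) (rule psi_off)
  have detL: "det (Lambda p \<mu> \<sigma> \<Psi>) = (\<Prod>l\<in>UNIV. Lambda_diag ?b l)"
    unfolding Lambda_def Lambda_of_eq_diag by (subst det_diagonal) auto
  have lt: "\<Psi> $ l $ l < Lambda_diag ?b l" for l
    using Lambda_diag_ge[of ?b l] b_sol_nonneg \<sigma> by (smt (verit) zero_less_power)
  then have "det \<Psi> < det (Lambda p \<mu> \<sigma> \<Psi>)"
    unfolding det detL
    by (intro prod_mono_strict) (auto simp: psi_nonneg Lambda_diag_pos b_sol_nonneg intro: less_imp_le)
  then have "ln (det \<Psi>) < ln (det (Lambda p \<mu> \<sigma> \<Psi>))" using pos by simp
  moreover have "1 \<le> 1 / (1 + ?b m) - ln (1 / (1 + ?b m))" for m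
    using ln_le_minus_one[of "1 / (1 + ?b m)"] b_sol_nonneg[of m] by simp
  then have "(\<Sum>m\<in>(UNIV::'m set). 1) \<le> (\<Sum>m\<in>UNIV. 1 / (1 + ?b m) - ln (1 / (1 + ?b m)))"
    by (intro sum_mono)
  ultimately show ?thesis unfolding nabla0_def by simp
qed

text \<open>Together with \<open>C0 \<ge> 0\<close> this gives the positive denominator that
  Dinkelbach's argument requires.\<close>

lemma rate_fh_pos: "0 < rate_fh \<kappa> p \<mu> \<sigma> \<Psi>"
proof (cases \<kappa>)
  case P2P
  let ?a = "\<lambda>l. (\<Sum>m\<in>UNIV. p m * \<mu> l m) + \<sigma>\<^sup>2 + \<Psi> $ l $ l"
  let ?t = "\<lambda>l. eln (ereal (?a l) / ereal (\<Psi> $ l $ l)) / ereal (ln 2)"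
  have summand_pos: "0 < ?t l" for l
  proof -
    have "0 \<le> (\<Sum>m\<in>UNIV. p m * \<mu> l m)" using p \<mu> by (simp add: sum_nonneg)
    then have a: "\<Psi> $ l $ l < ?a l" using \<sigma> by (simp add: add_nonneg_pos)
    show ?thesis
    proof (cases "\<Psi> $ l $ l = 0")
      case True
      then show ?thesis using a by (simp add: eln_def)
    next
      case False
      with psi_nonneg[of l] have "0 < \<Psi> $ l $ l" by simp
      with a have "1 < ?a l / \<Psi> $ l $ l" by simp
      with \<open>0 < \<Psi> $ l $ l\<close> show ?thesis by (simp add: eln_def)
    qed
  qed
  then have "0 \<le> sum ?t UNIV" by (intro sum_nonneg less_imp_le)
  moreover have "sum ?t UNIV \<noteq> 0"
    using summand_pos by (subst sum_nonneg_eq_0_iff) (auto simp: less_le)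
  ultimately show ?thesis unfolding P2P rate_fh.simps by simp
next
  case WZ
  show ?thesis
  proof (cases "0 < det \<Psi>")
    case True
    then show ?thesis
      using ln_det_less_nabla0 by (simp add: WZ eln_def)
  \<comment> \<open>If the determinant is not positive, \<open>eln\<close> returns -\<infinity> and
    the rate is \<infinity>.\<close>
  qed (simp add: WZ eln_def)
qed

end

section \<open>Maximization over \<Omega> for fixed \<Psi>\<close>

lemma Omega_opt_diag:
  assumes "0 < \<sigma>" "\<Psi> \<in> psi_set"
  shows "Omega_opt \<sigma> \<Psi> = (\<chi> i j. if i = j then of_real (1 / (\<Psi> $ i $ i + \<sigma>\<^sup>2)) else 0)"
proof -
  have off: "\<Psi> $ i $ j = 0" if "i \<noteq> j" for i j
    using assms(2) that unfolding psi_set_def by blast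
  have pos: "0 < \<Psi> $ i $ i + \<sigma>\<^sup>2" for i
    using assms unfolding psi_set_def by (simp add: add_nonneg_pos)
  have diag: "cmat (\<Psi> + mat (\<sigma>\<^sup>2)) $ i $ j = (if i = j then of_real (\<Psi> $ i $ i + \<sigma>\<^sup>2) else 0)" for i j
    by (simp add: cmat_def map_matrix_def mat_def off)
  show ?thesis
    unfolding Omega_opt_def using less_imp_neq[OF pos, symmetric]
    by (subst matrix_inv_diagonal) (simp_all add: diag vec_eq_iff del: of_real_add)
qed

lemma Omega_opt_psd:
  assumes "0 < \<sigma>" "\<Psi> \<in> psi_set"
  shows "Omega_opt \<sigma> \<Psi> \<in> psd_set"
proof -
  have pos: "0 < \<Psi> $ i $ i + \<sigma>\<^sup>2" for i
    using assms unfolding psi_set_def by (simp add: add_nonneg_pos)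
  have "(Omega_opt \<sigma> \<Psi> *v x) $ i = of_real (1 / (\<Psi> $ i $ i + \<sigma>\<^sup>2)) * x $ i" for x i
    by (simp add: Omega_opt_diag[OF assms] matrix_vector_mult_def mult_delta_left)
  then have "cnj (x $ i) * (Omega_opt \<sigma> \<Psi> *v x) $ i = of_real ((cmod (x $ i))\<^sup>2 / (\<Psi> $ i $ i + \<sigma>\<^sup>2))" for x i
    using complex_norm_square[of "x $ i"]
    by (simp add: mult.commute)
  then have "0 \<le> Re (\<Sum>i\<in>UNIV. cnj (x $ i) * (Omega_opt \<sigma> \<Psi> *v x) $ i)" for x
    using pos by (auto intro!: sum_nonneg divide_nonneg_pos simp del: of_real_add of_real_divide)
  then show ?thesis
    unfolding psd_set_def hermitian_def by (simp add: Omega_opt_diag[OF assms])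
qed

text \<open>Only the diagonal of \<Omega> enters the trace, so Hadamard's inequality reduces the
  maximization to scalar problems.\<close>

lemma trace_cmat_diag:
  assumes "\<Psi> \<in> psi_set"
  shows "Re (trace (\<Omega> ** cmat (\<Psi> + mat (\<sigma>\<^sup>2)))) = (\<Sum>l\<in>UNIV. Re (\<Omega> $ l $ l) * (\<Psi> $ l $ l + \<sigma>\<^sup>2))"
proof -
  have "cmat (\<Psi> + mat (\<sigma>\<^sup>2)) $ i $ j = (if i = j then of_real (\<Psi> $ i $ i + \<sigma>\<^sup>2) else 0)" for i j
    using assms by (simp add: psi_set_def cmat_def map_matrix_def mat_def)
  then show ?thesis
    by (simp add: trace_def matrix_matrix_mult_def mult_delta_right del: of_real_add)
qed

lemma Omega_opt_det:
  assumes "0 < \<sigma>" "\<Psi> \<in> psi_set"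
  shows "Re (det (Omega_opt \<sigma> \<Psi>)) = (\<Prod>l\<in>UNIV. 1 / (\<Psi> $ l $ l + \<sigma>\<^sup>2))"
proof -
  have "det (Omega_opt \<sigma> \<Psi>) = (\<Prod>l\<in>UNIV. complex_of_real (1 / (\<Psi> $ l $ l + \<sigma>\<^sup>2)))"
    by (subst det_diagonal) (simp_all add: Omega_opt_diag[OF assms])
  also have "\<dots> = of_real (\<Prod>l\<in>UNIV. 1 / (\<Psi> $ l $ l + \<sigma>\<^sup>2))"
    by (rule of_real_prod[symmetric])
  finally show ?thesis by (metis Re_complex_of_real)
qed

text \<open>After Hadamard's inequality the bound separates into terms
  \<open>ln (w l) - w l * a l\<close>, each largest at \<open>w l = 1 / a l\<close>, the diagonal
  entry of \<open>Omega_opt\<close>.\<close>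

lemma ln_det_minus_trace_le:
  fixes \<Omega> :: "complex^'l^'l"
  assumes "0 < \<sigma>" "\<Psi> \<in> psi_set" and \<Omega>: "\<Omega> \<in> psd_set" and pos: "0 < Re (det \<Omega>)"
  shows "ln (Re (det \<Omega>)) - Re (trace (\<Omega> ** cmat (\<Psi> + mat (\<sigma>\<^sup>2))))
    \<le> ln (Re (det (Omega_opt \<sigma> \<Psi>))) - Re (trace (Omega_opt \<sigma> \<Psi> ** cmat (\<Psi> + mat (\<sigma>\<^sup>2))))"
proof -
  define a where "a l = \<Psi> $ l $ l + \<sigma>\<^sup>2" for l
  define w where "w l = Re (\<Omega> $ l $ l)" for l
  have a: "0 < a l" for l
    using assms unfolding psi_set_def a_def by (simp add: add_nonneg_pos)
  have had: "Re (det \<Omega>) \<le> (\<Prod>l\<in>UNIV. w l)"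
    unfolding w_def by (rule psd_det_le_prod_diag[OF \<Omega>])
  \<comment> \<open>A positive determinant excludes zero diagonal entries, so every
    \<open>ln (w l)\<close> below has a positive argument.\<close>
  have "0 < prod w UNIV" using had pos by linarith
  then have "w l \<noteq> 0" for l
    by (metis UNIV_I finite less_irrefl prod_zero)
  then have w: "0 < w l" for l
    using psd_diag(1)[OF \<Omega>, of l] unfolding w_def by (simp add: less_le)
  have "ln (Re (det \<Omega>)) \<le> ln (\<Prod>l\<in>UNIV. w l)"
    using had pos by (metis ln_mono order_less_le_trans)
  also have "\<dots> = (\<Sum>l\<in>UNIV. ln (w l))"
    by (rule ln_prod) (simp_all add: w less_imp_neq[OF w, symmetric])
  also have "\<dots> \<le> (\<Sum>l\<in>UNIV. w l * a l - 1 - ln (a l))"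
  proof (rule sum_mono)
    fix l
    have "ln (w l * a l) \<le> w l * a l - 1"
      using w[of l] a[of l] by (intro ln_le_minus_one) simp
    then show "ln (w l) \<le> w l * a l - 1 - ln (a l)"
      using w[of l] a[of l] by (simp add: ln_mult)
  qed
  also have "\<dots> = (\<Sum>l\<in>UNIV. w l * a l) - real CARD('l) - (\<Sum>l\<in>UNIV. ln (a l))"
    by (simp add: sum_subtractf)
  finally have "ln (Re (det \<Omega>)) - (\<Sum>l\<in>UNIV. w l * a l) \<le> - (\<Sum>l\<in>UNIV. ln (a l)) - real CARD('l)"
    by simp
  moreover have "ln (Re (det (Omega_opt \<sigma> \<Psi>))) = - (\<Sum>l\<in>UNIV. ln (a l))"
    using a unfolding Omega_opt_det[OF assms(1,2)] a_def[symmetric]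
    by (subst ln_prod) (auto simp: ln_div sum_negf less_imp_neq[OF a, symmetric])
  moreover have "Re (trace (Omega_opt \<sigma> \<Psi> ** cmat (\<Psi> + mat (\<sigma>\<^sup>2)))) = real CARD('l)"
    using less_imp_neq[OF a, symmetric]
    by (simp add: trace_cmat_diag[OF assms(2)] Omega_opt_diag[OF assms(1,2)] a_def[symmetric] del: of_real_add)
  moreover have "Re (trace (\<Omega> ** cmat (\<Psi> + mat (\<sigma>\<^sup>2)))) = (\<Sum>l\<in>UNIV. w l * a l)"
    unfolding w_def a_def by (rule trace_cmat_diag[OF assms(2)])
  ultimately show ?thesis by simp
qed

text \<open>Confines the extended arithmetic to one case distinction: \<open>f_obj\<close> is real
  or -\<infinity>, never \<infinity>.\<close>

lemma f_obj_eq: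
  fixes \<Omega> :: "complex^'l^'l"
  shows "f_obj N pM \<nu> p \<mu> \<sigma> \<Psi> \<Omega> = (if 0 < Re (det \<Omega>) then
    ereal (rate_B N pM \<nu> \<sigma> + 1 / ln 2 * (nabla0 p \<mu> \<sigma> \<Psi> + (ln (Re (det \<Omega>))
      - Re (trace (\<Omega> ** cmat (\<Psi> + mat (\<sigma>\<^sup>2))))) + real CARD('l))) else - \<infinity>)"
  unfolding f_obj_def eln_def by simp

lemma f_obj_le_Omega_opt:
  assumes "0 < \<sigma>" "\<Psi> \<in> psi_set" "\<Omega> \<in> psd_set"
  shows "f_obj N pM \<nu> p \<mu> \<sigma> \<Psi> \<Omega> \<le> f_obj N pM \<nu> p \<mu> \<sigma> \<Psi> (Omega_opt \<sigma> \<Psi>)"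
proof (cases "0 < Re (det \<Omega>)")
  case True
  have "0 < Re (det (Omega_opt \<sigma> \<Psi>))"
    using assms unfolding Omega_opt_det[OF assms(1,2)]
    by (intro prod_pos) (auto simp: psi_set_def intro: add_nonneg_pos)
  then show ?thesis
    using True ln_det_minus_trace_le[OF assms True]
    by (simp add: f_obj_eq divide_right_mono)
qed (simp add: f_obj_eq)

section \<open>Dinkelbach's equivalence\<close>

theorem proposition1:
  fixes p :: "'m::finite \<Rightarrow> real" and \<mu> :: "'l::finite \<Rightarrow> 'm \<Rightarrow> real"
    and pM \<nu> :: "'k::finite \<Rightarrow> real" and \<sigma> C0 :: real and \<kappa> :: compression
    and \<Psi>s :: "real^'l^'l" and \<Omega>s :: "complex^'l^'l" and \<omega>s :: ereal
    and f :: "real^'l^'l \<Rightarrow> complex^'l^'l \<Rightarrow> ereal" and g :: "real^'l^'l \<Rightarrow> ereal"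
  assumes "\<sigma> > 0" and "C0 \<ge> 0"
    and "\<And>m. p m \<ge> 0" and "\<And>l m. \<mu> l m \<ge> 0"
    and "\<And>k. pM k \<ge> 0" and "\<And>k. \<nu> k \<ge> 0"
    and f_def: "f = f_obj TYPE('n::finite) pM \<nu> p \<mu> \<sigma>"
    and g_def: "g = g_obj \<kappa> C0 p \<mu> \<sigma>"
    and f_cont: "continuous_on (psi_set \<times> psd_set) (\<lambda>(\<Psi>, \<Omega>). f \<Psi> \<Omega>)"
    and g_cont: "continuous_on psi_set g"
    and f_pos: "\<And>\<Psi>. \<Psi> \<in> psi_set \<Longrightarrow> f \<Psi> (Omega_opt \<sigma> \<Psi>) > 0"
    and "\<Psi>s \<in> psi_set" and g_fin: "g \<Psi>s < \<infinity>"
    and "\<Omega>s = Omega_opt \<sigma> \<Psi>s"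
    and "\<omega>s = f \<Psi>s \<Omega>s / g \<Psi>s"
  shows "(\<exists>\<Omega>. is_arg_max (\<lambda>(\<Psi>, \<Omega>). f \<Psi> \<Omega> / g \<Psi>) (\<lambda>(\<Psi>, \<Omega>). \<Psi> \<in> psi_set \<and> \<Omega> \<in> psd_set) (\<Psi>s, \<Omega>)) \<longleftrightarrow>
    is_arg_max (\<lambda>(\<Psi>, \<Omega>). f \<Psi> \<Omega> - \<omega>s * g \<Psi>) (\<lambda>(\<Psi>, \<Omega>). \<Psi> \<in> psi_set \<and> \<Omega> \<in> psd_set) (\<Psi>s, \<Omega>s)"
    (is "(\<exists>\<Omega>. is_arg_max ?ratio ?P (\<Psi>s, \<Omega>)) \<longleftrightarrow> is_arg_max ?diff ?P (\<Psi>s, \<Omega>s)")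
proof -
  have g_pos: "0 < g \<Psi>" if "\<Psi> \<in> psi_set" for \<Psi>
    using rate_fh_pos[of \<sigma> p \<mu> \<Psi> \<kappa>] assms that
    unfolding g_def g_obj_def by (simp add: add_pos_nonneg)
  have f_fin: "f \<Psi> \<Omega> \<noteq> \<infinity>" for \<Psi> \<Omega>
    unfolding f_def f_obj_eq by simp
  have f_le: "f \<Psi> \<Omega> \<le> f \<Psi> (Omega_opt \<sigma> \<Psi>)" if "\<Psi> \<in> psi_set" "\<Omega> \<in> psd_set" for \<Psi> \<Omega>
    unfolding f_def using \<open>\<sigma> > 0\<close> that by (rule f_obj_le_Omega_opt)
  have P: "?P (\<Psi>s, \<Omega>s)"
    using assms Omega_opt_psd by auto
  obtain F where F: "f \<Psi>s \<Omega>s = ereal F" "0 < F"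
    using f_pos[OF \<open>\<Psi>s \<in> psi_set\<close>] f_fin[of \<Psi>s \<Omega>s] assms(14) by (cases "f \<Psi>s \<Omega>s") auto
  obtain G where G: "g \<Psi>s = ereal G" "0 < G"
    using g_pos[OF \<open>\<Psi>s \<in> psi_set\<close>] g_fin by (cases "g \<Psi>s") auto
  \<comment> \<open>A positive real: hence \<open>\<omega>s * g \<Psi>\<close> is \<infinity>
    wherever \<open>g \<Psi>\<close> is, and the ratio 0 found there stays below
    \<open>\<omega>s\<close>.\<close>
  have \<omega>: "\<omega>s = ereal (F / G)"
    using assms(15) F G by simp
  have at_opt: "?ratio (\<Psi>s, \<Omega>s) = \<omega>s" "?diff (\<Psi>s, \<Omega>s) = 0"
    using F G \<omega> by simp_all
  \<comment> \<open>Where \<open>g\<close> is infinite the ratio is 0 (in \<^typ>\<open>ereal\<close>, even \<open>- \<infinity> / \<infinity> = 0\<close>) and the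
    difference is \<open>- \<infinity>\<close>.\<close>
  have iff: "?ratio (\<Psi>, \<Omega>) \<le> \<omega>s \<longleftrightarrow> ?diff (\<Psi>, \<Omega>) \<le> 0" if "\<Psi> \<in> psi_set" for \<Psi> \<Omega>
    using g_pos[OF that] f_fin[of \<Psi> \<Omega>] F(2) G(2) unfolding \<omega>
    by (cases "f \<Psi> \<Omega>"; cases "g \<Psi>") (auto simp: field_simps)
  \<comment> \<open>The optimum on the left may pair \<open>\<Psi>s\<close> with any \<Omega>; none
    of these improves on \<open>\<Omega>s\<close>.\<close>
  have ratio_le: "?ratio (\<Psi>s, \<Omega>) \<le> \<omega>s" if "\<Omega> \<in> psd_set" for \<Omega>
    using f_le[OF \<open>\<Psi>s \<in> psi_set\<close> that] G assms(14,15)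
    by (simp add: ereal_divide_right_mono)
  \<comment> \<open>As \<open>\<omega>s\<close> is attained at \<open>\<Omega>s\<close> and bounds
    all ratios at \<open>\<Psi>s\<close>, optimality of \<open>\<Psi>s\<close> means that
    \<open>\<omega>s\<close> bounds every feasible ratio.\<close>
  have "(\<exists>\<Omega>. is_arg_max ?ratio ?P (\<Psi>s, \<Omega>)) \<longleftrightarrow>
      (\<forall>\<Psi>\<in>psi_set. \<forall>\<Omega>\<in>psd_set. ?ratio (\<Psi>, \<Omega>) \<le> \<omega>s)"
  proof (intro iffI ballI)
    fix \<Psi> :: "real^'l^'l" and \<Omega>' :: "complex^'l^'l"
    assume "\<exists>\<Omega>. is_arg_max ?ratio ?P (\<Psi>s, \<Omega>)" and feasible: "\<Psi> \<in> psi_set" "\<Omega>' \<in> psd_set"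
    then obtain \<Omega> where "is_arg_max ?ratio ?P (\<Psi>s, \<Omega>)" by blast
    then have \<Omega>: "?P (\<Psi>s, \<Omega>)" and "?P (\<Psi>, \<Omega>') \<Longrightarrow> ?ratio (\<Psi>, \<Omega>') \<le> ?ratio (\<Psi>s, \<Omega>)"
      unfolding is_arg_max_linorder by blast+
    then have "?ratio (\<Psi>, \<Omega>') \<le> ?ratio (\<Psi>s, \<Omega>)" using feasible by simp
    also have "\<dots> \<le> \<omega>s" using ratio_le \<Omega> by simp
    finally show "?ratio (\<Psi>, \<Omega>') \<le> \<omega>s" .
  next
    assume le: "\<forall>\<Psi>\<in>psi_set. \<forall>\<Omega>\<in>psd_set. ?ratio (\<Psi>, \<Omega>) \<le> \<omega>s"
    have "is_arg_max ?ratio ?P (\<Psi>s, \<Omega>s)"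
      unfolding is_arg_max_linorder at_opt using P le by auto
    then show "\<exists>\<Omega>. is_arg_max ?ratio ?P (\<Psi>s, \<Omega>)" by blast
  qed
  also have "\<dots> \<longleftrightarrow> (\<forall>\<Psi>\<in>psi_set. \<forall>\<Omega>\<in>psd_set. ?diff (\<Psi>, \<Omega>) \<le> 0)"
    using iff by blast
  \<comment> \<open>The difference is 0 at \<open>(\<Psi>s, \<Omega>s)\<close>, so the upper bound 0
    is attained there.\<close>
  also have "\<dots> \<longleftrightarrow> is_arg_max ?diff ?P (\<Psi>s, \<Omega>s)"
    using P at_opt(2) unfolding is_arg_max_linorder by auto
  finally show ?thesis .
qed

end
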